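(* Let $p$ be a prime number and let $F$ be a field of characteristic $p$. Let $A$ and $A'$ be two central division algebras of degree $p$ over $F$. If $A$ and $A'$ are right linked, then $A$ and $A'$ are left linked.
   Context: A $p$-algebra is a central simple algebra of prime power degree $p^m$ over a field $F$ of characteristic $p$; the two algebras in the claim are division $p$-algebras of prime degree with the same center $F$. For $\alpha \in F$ and $\beta \in F^\times$, the symbol $[\alpha,\beta)_{p,F}$ denotes the $F$-algebra generated by $x$ and $y$ subject to the relations $x^p-x=\alpha$, $y^p=\beta$ and $yxy^{-1}=x+1$; it is a central simple algebra of degree $p$ over $F$. A symbol presentation of an $F$-algebra $A$ is an $F$-algebra isomorphism $A\cong[\alpha,\beta)_{p,F}$ for some $\alpha\in F$, $\beta\in F^\times$ (it is not unique in general). Two algebras $A, A'$ over $F$ are right linked if there exist $\alpha,\gamma\in F$ and $\beta\in F^\times$ with $A\cong[\alpha,\beta)_{p,F}$ and $A'\cong[\gamma,\beta)_{p,F}$. They are left linked if there exist $\alpha\in F$ and $\beta,\delta\in F^\times$ with $A\cong[\alpha,\beta)_{p,F}$ and $A'\cong[\alpha,\delta)_{p,F}$. *)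

theory Defs
  imports Complex_Main "HOL-Algebra.QuotRing" "HOL-Algebra.Module" "HOL-Library.Poly_Mapping"
    "HOL-Computational_Algebra.Primes"
begin

text \<open>Algebras over a field: unital, associative, not necessarily commutative.\<close>

locale field_algebra = vector_space scale
  for scale :: "'f::field \<Rightarrow> 'a::ring_1 \<Rightarrow> 'a" +
  assumes scale_mult_left: "scale c a * b = scale c (a * b)"
    and scale_mult_right: "a * scale c b = scale c (a * b)"

locale central_division_algebra = field_algebra scale
  for scale :: "'f::field \<Rightarrow> 'a::division_ring \<Rightarrow> 'a" and n :: nat +
  assumes center_eq: "{z. \<forall>a. z * a = a * z} = range (\<lambda>c. scale c 1)"
    and finite_dimensional: "\<exists>B. finite B \<and> span B = UNIV"
    and degree: "dim UNIV = n ^ 2"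

text \<open>
  Quotients by a relation ideal depend on terms, so they are not types. Isomorphism with them is
  therefore stated for algebra records; the following turns a type-based algebra into such a record.
\<close>

definition algebra_of :: "('f::field \<Rightarrow> 'a::ring_1 \<Rightarrow> 'a) \<Rightarrow> ('f, 'a) module" where
  "algebra_of scale =
     \<lparr>carrier = UNIV, monoid.mult = (*), one = 1, zero = 0, add = (+), smult = scale\<rparr>"

definition quotient_algebra :: "('f, 'a) module \<Rightarrow> 'a set \<Rightarrow> ('f, 'a set) module" where
  "quotient_algebra A I =
     ring.extend (A Quot I) (module.fields (\<lambda>c X. \<Union>x\<in>X. I +>\<^bsub>A\<^esub> (c \<odot>\<^bsub>A\<^esub> x)))"

definition algebra_isomorphic :: "('f, 'a) module \<Rightarrow> ('f, 'b) module \<Rightarrow> bool" where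
  "algebra_isomorphic A B \<longleftrightarrow>
     (\<exists>h \<in> ring_iso A B. \<forall>c. \<forall>a \<in> carrier A. h (c \<odot>\<^bsub>A\<^esub> a) = c \<odot>\<^bsub>B\<^esub> h a)"

text \<open>
  The free algebra on two generators is the monoid algebra of the free monoid of words:
  its elements are the finitely supported functions on words, multiplied by convolution with respect
  to the (additively written) word monoid, whose operation is concatenation.
\<close>

datatype generator = Gen_x | Gen_y

instantiation list :: (type) monoid_add
begin

definition zero_list :: "'a list" where "zero_list = []"

definition plus_list :: "'a list \<Rightarrow> 'a list \<Rightarrow> 'a list" where "plus_list = append"

instance
  by standard (simp_all add: zero_list_def plus_list_def)

end

type_synonym 'f free_algebra = "generator list \<Rightarrow>\<^sub>0 'f"

definition free_const :: "'f::field \<Rightarrow> 'f free_algebra" where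
  "free_const c = Poly_Mapping.single [] c"

definition free_gen :: "generator \<Rightarrow> 'f::field free_algebra" where
  "free_gen g = Poly_Mapping.single [g] 1"

definition free_algebra :: "('f::field, 'f free_algebra) module" where
  "free_algebra = algebra_of (\<lambda>c f. free_const c * f)"

text \<open>
  As \<open>\<beta> \<noteq> 0\<close>, the relation \<open>y ^ p = \<beta>\<close> makes \<open>y\<close> invertible, so that
  \<open>y x y\<^sup>-\<^sup>1 = x + 1\<close> can be written as \<open>y x = (x + 1) y\<close> in the free algebra.
\<close>

definition symbol_relators :: "nat \<Rightarrow> 'f::field \<Rightarrow> 'f \<Rightarrow> 'f free_algebra set" where
  "symbol_relators p \<alpha> \<beta> =
     (let x = free_gen Gen_x; y = free_gen Gen_y in
       {x ^ p - x - free_const \<alpha>, y ^ p - free_const \<beta>, y * x - (x + 1) * y})"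

definition symbol_algebra :: "nat \<Rightarrow> 'f::field \<Rightarrow> 'f \<Rightarrow> ('f, 'f free_algebra set) module" where
  "symbol_algebra p \<alpha> \<beta> =
     quotient_algebra free_algebra (Idl\<^bsub>free_algebra\<^esub> (symbol_relators p \<alpha> \<beta>))"

definition symbol_presentation ::
    "nat \<Rightarrow> ('f::field \<Rightarrow> 'a::ring_1 \<Rightarrow> 'a) \<Rightarrow> 'f \<Rightarrow> 'f \<Rightarrow> bool" where
  "symbol_presentation p scale \<alpha> \<beta> \<longleftrightarrow>
     \<beta> \<noteq> 0 \<and> algebra_isomorphic (algebra_of scale) (symbol_algebra p \<alpha> \<beta>)"

definition right_linked ::
    "nat \<Rightarrow> ('f::field \<Rightarrow> 'a::ring_1 \<Rightarrow> 'a) \<Rightarrow> ('f \<Rightarrow> 'b::ring_1 \<Rightarrow> 'b) \<Rightarrow> bool" where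
  "right_linked p scale scale' \<longleftrightarrow>
     (\<exists>\<alpha> \<gamma> \<beta>. symbol_presentation p scale \<alpha> \<beta> \<and> symbol_presentation p scale' \<gamma> \<beta>)"

definition left_linked ::
    "nat \<Rightarrow> ('f::field \<Rightarrow> 'a::ring_1 \<Rightarrow> 'a) \<Rightarrow> ('f \<Rightarrow> 'b::ring_1 \<Rightarrow> 'b) \<Rightarrow> bool" where
  "left_linked p scale scale' \<longleftrightarrow>
     (\<exists>\<alpha> \<beta> \<delta>. symbol_presentation p scale \<alpha> \<beta> \<and> symbol_presentation p scale' \<alpha> \<delta>)"

end

theory Submission
  imports Defs "HOL-Computational_Algebra.Polynomial" "HOL-Number_Theory.Cong"
begin

text \<open>
  Let \<open>x, y\<close> and \<open>x', y'\<close> be the standard generators of \<open>[\<alpha>, \<beta>)\<close> and \<open>[\<gamma>, \<beta>)\<close>.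
  Two observations reduce the theorem to solving one equation in \<open>F\<close>.

  First, in a central division algebra of degree \<open>p\<close>, every noncentral \<open>t\<close> with
  \<open>t ^ p - t = \<tau> \<in> F\<close> is the first generator of some presentation \<open>[\<tau>, \<delta>)\<close>.
  The usual proof takes the second generator from the Skolem--Noether theorem. Here it is found by
  diagonalising: \<open>D w = t w - w t\<close> satisfies \<open>D (D - 1) \<dots> (D - (p - 1)) = 0\<close>,
  so \<open>D\<close>, being nonzero, has an eigenvector \<open>v\<close> for a nonzero eigenvalue in the prime
  field, and a suitable power \<open>z\<close> of \<open>v\<close> satisfies \<open>z t = (t + 1) z\<close>
  (\<open>exists_shifting_element\<close>). The \<open>p\<^sup>2\<close> elements \<open>t\<^sup>i z\<^sup>j\<close> are
  independent, hence a basis; this makes \<open>z ^ p\<close> central and identifies the algebra with the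
  abstract quotient of the free algebra, since that quotient is spanned by the corresponding
  monomials (\<open>shifting_pair.symbol_presentation\<close>).

  Second, whenever \<open>u x = (x + 1) u\<close>, the element \<open>t = x + u\<close> satisfies
  \<open>t ^ p - t = x ^ p - x + u ^ p\<close> (\<open>artin_schreier_add_intertwined\<close>). For
  \<open>u = y (x + a)\<close> with \<open>a \<in> F\<close>, the power \<open>u ^ p\<close> is \<open>\<beta>\<close> times the norm of
  \<open>x + a\<close>, so that \<open>t ^ p - t = \<alpha> + \<beta> (\<alpha> + a ^ p - a)\<close>. For \<open>u' = a y'\<close> the
  same computation gives \<open>\<gamma> + \<beta> a ^ p\<close>. The terms \<open>\<beta> a ^ p\<close> agree, so equality of the
  two constants is a linear equation for \<open>a\<close>, solved by \<open>a = (\<alpha> - \<gamma>) / \<beta> + \<alpha>\<close>.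

  The main computations in characteristic \<open>p\<close> are made with falling factorials
  \<open>x (x - 1) \<dots> (x - n + 1)\<close>. They satisfy binomial identities also for the noncommuting
  elements at hand, and for \<open>n = p\<close> they become \<open>x ^ p - x\<close>, while the inner binomial
  coefficients vanish.
\<close>

section \<open>Falling factorials in noncommutative rings\<close>

primrec falling :: "'a::ring_1 \<Rightarrow> nat \<Rightarrow> 'a" where
  "falling x 0 = 1"
| "falling x (Suc n) = (x - of_nat n) * falling x n"

lemma mult_of_nat_left_commute:
  "a * (of_nat n * b) = of_nat n * (a * (b::'a::semiring_1))"
  by (metis mult.assoc mult_of_nat_commute)

lemma falling_intertwine:
  assumes "u * x = x' * u"
  shows "u * falling x n = falling x' n * u"
proof (induction n)
  case (Suc n)
  have "u * falling x (Suc n) = (u * (x - of_nat n)) * falling x n"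
    by (simp add: mult.assoc)
  also have "u * (x - of_nat n) = (x' - of_nat n) * u"
    using assms by (simp add: algebra_simps mult_of_nat_commute)
  finally show ?case
    using Suc by (simp add: mult.assoc)
qed simp

lemma falling_plus_one:
  "falling (x + 1) (Suc m) = (x + 1) * falling x m"
proof (induction m)
  case (Suc m)
  have "falling (x + 1) (Suc (Suc m)) = (x - of_nat m) * ((x + 1) * falling x m)"
    using Suc by simp
  also have "\<dots> = (x + 1) * ((x - of_nat m) * falling x m)"
    by (simp add: algebra_simps mult_of_nat_commute)
  finally show ?case by simp
qed simp

lemma falling_difference:
  "falling (x + 1) m = falling x m + of_nat m * falling x (m - 1)"
proof (cases m)
  case (Suc n)
  have "(x + 1) * falling x n = falling x (Suc n) + of_nat (Suc n) * falling x n"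
    by (simp add: algebra_simps)
  then show ?thesis
    by (simp add: Suc falling_plus_one del: falling.simps)
qed simp

text \<open>
  The common induction step of the three binomial expansions below, which differ only in the
  array \<open>A\<close>.
\<close>

lemma sum_binomial_Suc:
  fixes A :: "nat \<Rightarrow> nat \<Rightarrow> 'a::semiring_1"
  shows "(\<Sum>k\<le>n. of_nat (n choose k) * (A (Suc (n - k)) k + A (n - k) (Suc k)))
       = (\<Sum>k\<le>Suc n. of_nat (Suc n choose k) * A (Suc n - k) k)"
proof -
  let ?B = "\<lambda>k. A (Suc n - k) k"
  have "(\<Sum>k\<le>Suc n. of_nat (Suc n choose k) * ?B k)
      = ?B 0 + (\<Sum>k\<le>n. of_nat (Suc n choose Suc k) * ?B (Suc k))"
    by (simp add: sum.atMost_Suc_shift del: sum.atMost_Suc)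
  also have "\<dots> = (?B 0 + (\<Sum>k\<le>n. of_nat (n choose Suc k) * ?B (Suc k)))
                + (\<Sum>k\<le>n. of_nat (n choose k) * ?B (Suc k))"
    by (simp add: sum.distrib algebra_simps)
  also have "?B 0 + (\<Sum>k\<le>n. of_nat (n choose Suc k) * ?B (Suc k))
      = (\<Sum>k\<le>Suc n. of_nat (n choose k) * ?B k)"
    by (simp add: sum.atMost_Suc_shift del: sum.atMost_Suc)
  also have "\<dots> = (\<Sum>k\<le>n. of_nat (n choose k) * A (Suc (n - k)) k)"
    by (simp add: Suc_diff_le binomial_eq_0)
  finally show ?thesis
    by (simp add: sum.distrib distrib_left)
qed

lemma sum_binomial_prime:
  fixes B :: "nat \<Rightarrow> 'a::ring_1"
  assumes "prime p" and "of_nat p = (0::'a)"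
  shows "(\<Sum>k\<le>p. of_nat (p choose k) * B k) = B 0 + B p"
proof -
  have "p > 0" using assms(1) by (rule prime_gt_0_nat)
  have "(\<Sum>k\<le>p. of_nat (p choose k) * B k) = (\<Sum>k\<in>{0,p}. of_nat (p choose k) * B k)"
  proof (intro sum.mono_neutral_right ballI)
    fix k assume k: "k \<in> {..p} - {0, p}"
    then have "p dvd (p choose k)"
      by (intro dvd_choose_prime assms) auto
    then have "of_nat (p choose k) = (0::'a)"
      using assms(2) by (auto elim!: dvdE)
    then show "of_nat (p choose k) * B k = 0" by simp
  qed auto
  then show ?thesis using \<open>p > 0\<close> by simp
qed

text \<open>
  The Vandermonde identity for \<open>x + u\<close>, with powers of \<open>u\<close> in place of its falling
  factorials. The reason is that \<open>u\<close> is not a commuting variable but a shift operator: moving it past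
  a falling factorial of \<open>x\<close> produces a correction by \<open>falling_difference\<close>, and these
  corrections telescope.
\<close>

lemma falling_add_intertwined:
  assumes ux: "u * x = (x + 1) * u"
  shows "falling (x + u) n = (\<Sum>k\<le>n. of_nat (n choose k) * (falling x (n - k) * u ^ k))"
proof (induction n)
  case (Suc n)
  define A where "A m k = falling x m * u ^ k" for m k
  \<comment> \<open>The correction terms; they telescope when the expansion for \<open>n\<close> is multiplied by
    \<open>x + u - n\<close>.\<close>
  define g where "g k = of_nat (k * (n choose k)) * A (n - k) k" for k
  have step: "(x + u - of_nat n) * (of_nat (n choose k) * A (n - k) k)
      = of_nat (n choose k) * (A (Suc (n - k)) k + A (n - k) (Suc k)) + (g (Suc k) - g k)"
    if "k \<le> n" for k
  proof -
    have n: "of_nat n = (of_nat (n - k) + of_nat k :: 'a)"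
      using that by (simp flip: of_nat_add)
    have 1: "(x - of_nat n) * A (n - k) k = A (Suc (n - k)) k - of_nat k * A (n - k) k"
      unfolding n A_def by (simp add: algebra_simps)
    have "u * A (n - k) k = falling (x + 1) (n - k) * u ^ Suc k"
      by (simp add: A_def falling_intertwine[OF ux] flip: mult.assoc)
    then have 2: "u * A (n - k) k = A (n - k) (Suc k) + of_nat (n - k) * A (n - Suc k) (Suc k)"
      by (simp add: A_def falling_difference distrib_right mult.assoc del: power_Suc)
    have "Suc k * (n choose Suc k) = (n - k) * (n choose k)"
      using binomial_absorb_comp[of n k] that
      by (metis Suc_times_binomial_eq binomial_absorption mult.commute)
    then have "g (Suc k) = of_nat ((n choose k) * (n - k)) * A (n - Suc k) (Suc k)"
      unfolding g_def by (simp only: mult.commute)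
    then have g: "g (Suc k) = of_nat (n choose k) * (of_nat (n - k) * A (n - Suc k) (Suc k))"
      by (simp only: of_nat_mult mult.assoc)
    have "(x + u - of_nat n) * (of_nat (n choose k) * A (n - k) k)
        = of_nat (n choose k) * ((x + u - of_nat n) * A (n - k) k)"
      by (rule mult_of_nat_left_commute)
    also have "(x + u - of_nat n) * A (n - k) k = (x - of_nat n) * A (n - k) k + u * A (n - k) k"
      by (simp add: algebra_simps)
    also have "of_nat (n choose k) * ((x - of_nat n) * A (n - k) k + u * A (n - k) k)
      = of_nat (n choose k) * (A (Suc (n - k)) k + A (n - k) (Suc k))
       + (g (Suc k) - of_nat (n choose k) * (of_nat k * A (n - k) k))"
      unfolding 1 2 g by (simp add: algebra_simps)
    also have "of_nat (n choose k) * (of_nat k * A (n - k) k) = g k"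
      unfolding g_def mult.commute[of k] by (simp only: of_nat_mult mult.assoc)
    finally show ?thesis .
  qed
  have "falling (x + u) (Suc n)
      = (\<Sum>k\<le>n. (x + u - of_nat n) * (of_nat (n choose k) * A (n - k) k))"
    by (simp add: Suc A_def sum_distrib_left)
  also have "\<dots> = (\<Sum>k\<le>n. of_nat (n choose k) * (A (Suc (n - k)) k + A (n - k) (Suc k)))
      + (\<Sum>k\<le>n. g (Suc k) - g k)"
    by (simp add: step sum.distrib del: sum_subtractf)
  also have "(\<Sum>k\<le>n. g (Suc k) - g k) = g (Suc n) - g 0"
    by (simp add: sum_lessThan_telescope flip: lessThan_Suc_atMost del: sum.lessThan_Suc)
  also have "\<dots> = 0" by (simp add: g_def binomial_eq_0)
  finally show ?case unfolding sum_binomial_Suc by (simp only: A_def add_0_right)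
qed simp

text \<open>
  Moving all factors \<open>y\<close> to the left shifts the successive factors \<open>s\<close> to
  \<open>s, s - 1, \<dots>, s - n + 1\<close>. For \<open>n = p\<close> their product is the norm of \<open>s\<close>.
\<close>

lemma power_mult_intertwined:
  assumes ys: "y * s = (s + 1) * (y::'a::ring_1)"
  shows "(y * s) ^ n = y ^ n * falling s n"
proof (induction n)
  case (Suc n)
  have s: "s * y ^ n = y ^ n * (s - of_nat n)" for n
  proof (induction n)
    case (Suc n)
    have "s * y ^ Suc n = (y * s - y) * y ^ n"
      by (simp add: ys algebra_simps)
    also have "\<dots> = y * (s * y ^ n) - y * y ^ n" by (simp add: algebra_simps)
    finally show ?case
      unfolding Suc by (simp add: algebra_simps)
  qed simp
  show ?case
    using Suc by (simp add: s mult.assoc) (simp add: s flip: mult.assoc)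
qed simp

text \<open>
  The falling factorial of the operator \<open>w \<mapsto> t w - w t\<close>, applied to \<open>w\<close>.
\<close>

primrec ad_falling :: "'a::ring_1 \<Rightarrow> 'a \<Rightarrow> nat \<Rightarrow> 'a" where
  "ad_falling t w 0 = w"
| "ad_falling t w (Suc n) = t * ad_falling t w n - ad_falling t w n * t - of_nat n * ad_falling t w n"

text \<open>
  Vandermonde's identity for the sum of two commuting operators, left multiplication by
  \<open>t\<close> and right multiplication by \<open>- t\<close>.
\<close>

lemma ad_falling_eq:
  "ad_falling t w n = (\<Sum>k\<le>n. of_nat (n choose k) * (falling t (n - k) * w * falling (- t) k))"
proof (induction n)
  case (Suc n)
  define A where "A m k = falling t m * w * falling (- t) k" for m k
  have step: "t * A (n - k) k - A (n - k) k * t - of_nat n * A (n - k) k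
     = A (Suc (n - k)) k + A (n - k) (Suc k)" if "k \<le> n" for k
  proof -
    have n: "of_nat n = (of_nat (n - k) + of_nat k :: 'a)"
      using that by (simp flip: of_nat_add)
    have 1: "t * A (n - k) k = A (Suc (n - k)) k + of_nat (n - k) * A (n - k) k"
      by (simp add: A_def algebra_simps)
    have "- t * falling (- t) k = falling (- t) k * (- t)"
      using falling_intertwine[of "- t" "- t" "- t" k] by simp
    then have "falling (- t) (Suc k) = - (falling (- t) k * t) - falling (- t) k * of_nat k"
      by (simp only: falling.simps left_diff_distrib mult_of_nat_commute mult_minus_right)
    then have "A (n - k) (Suc k) = - (A (n - k) k * t) - A (n - k) k * of_nat k"
      unfolding A_def by (simp only: right_diff_distrib mult.assoc mult_minus_right)
    then have 2: "A (n - k) (Suc k) = - (A (n - k) k * t) - of_nat k * A (n - k) k"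
      by (simp only: mult_of_nat_commute)
    show ?thesis
      unfolding 1 2 n by (simp add: algebra_simps)
  qed
  have "ad_falling t w (Suc n) = (\<Sum>k\<le>n. t * (of_nat (n choose k) * A (n - k) k)
      - (of_nat (n choose k) * A (n - k) k) * t - of_nat n * (of_nat (n choose k) * A (n - k) k))"
    by (simp add: Suc sum_distrib_left sum_distrib_right sum_subtractf flip: A_def)
  also have "\<dots> = (\<Sum>k\<le>n. of_nat (n choose k) *
      (t * A (n - k) k - A (n - k) k * t - of_nat n * A (n - k) k))"
    by (simp only: mult_of_nat_left_commute[of t] mult_of_nat_left_commute[of "of_nat n"]
        mult.assoc right_diff_distrib)
  also have "\<dots> = (\<Sum>k\<le>n. of_nat (n choose k) * (A (Suc (n - k)) k + A (n - k) (Suc k)))"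
    by (simp add: step)
  also have "\<dots> = (\<Sum>k\<le>Suc n. of_nat (Suc n choose k) * A (Suc n - k) k)"
    by (rule sum_binomial_Suc)
  finally show ?case unfolding A_def .
qed simp

section \<open>Algebras over a field of prime characteristic\<close>

lemma of_nat_power_prime_char:
  assumes "prime p" "CHAR('f::field) = p"
  shows "(of_nat i :: 'f) ^ p = of_nat i"
proof (induction i)
  case 0
  show ?case using prime_gt_0_nat[OF assms(1)] by simp
next
  case (Suc i)
  have "(1 + of_nat i :: 'f) ^ p = 1 ^ p + of_nat i ^ p"
    by (rule freshmans_dream) (use assms in auto)
  then show ?case by (simp add: Suc)
qed

text \<open>
  The elements of the prime field are \<open>p\<close> common roots of both sides, which are monic of degree
  \<open>p\<close>.
\<close>

lemma prod_linear_factors_prime_char: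
  assumes p: "prime p" and char: "CHAR('f::field) = p"
  shows "(\<Prod>i<p. [:- of_nat i, 1:]) = (monom 1 p - monom 1 1 :: 'f poly)"
proof (rule poly_eqI_degree_lead_coeff)
  let ?P = "\<lambda>n. \<Prod>i<n. [:- of_nat i, 1 :: 'f:]"
  have P: "degree (?P n) = n \<and> coeff (?P n) n = 1" for n
  proof -
    have d: "degree (?P n) = n"
      by (subst degree_prod_eq_sum_degree) auto
    moreover have "lead_coeff (?P n) = 1"
      by (simp add: lead_coeff_prod)
    ultimately show ?thesis by metis
  qed
  have "p > 1" using p by (rule prime_gt_1_nat)
  then show "coeff (?P p) p = coeff (monom 1 p - monom 1 1) p"
    using P[of p] by simp
  have "inj_on (of_nat :: nat \<Rightarrow> 'f) {..<p}"
    by (auto simp: inj_on_def of_nat_eq_iff_cong_CHAR char cong_def)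
  then show "p \<le> card ((of_nat :: nat \<Rightarrow> 'f) ` {..<p})"
    by (simp add: card_image)
  show "degree (?P p) \<le> p" using P[of p] by simp
  show "degree (monom 1 p - monom 1 1 :: 'f poly) \<le> p"
    using \<open>p > 1\<close> by (intro degree_diff_le) (auto simp: degree_monom_eq)
  fix z :: 'f assume "z \<in> of_nat ` {..<p}"
  then obtain i where i: "i < p" "z = of_nat i" by auto
  then have "poly (?P p) z = 0"
    by (auto simp: poly_prod)
  then show "poly (?P p) z = poly (monom 1 p - monom 1 1) z"
    using of_nat_power_prime_char[OF p char, of i] i by (simp add: poly_monom)
qed

context field_algebra
begin

lemma scale_one_mult [simp]: "scale c 1 * a = scale c a"
  by (simp add: scale_mult_left)

lemma mult_scale_one [simp]: "a * scale c 1 = scale c a"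
  by (simp add: scale_mult_right)

lemma scale_of_nat: "scale (of_nat n) a = of_nat n * a"
  by (induction n) (simp_all add: scale_left_distrib distrib_right)

lemma of_nat_CHAR: "CHAR('f) = p \<Longrightarrow> of_nat p = (0::'a)"
  using scale_of_nat[of p 1] by (metis mult_1_right of_nat_CHAR scale_zero_left)

lemma scale_one_power: "scale c 1 ^ n = scale (c ^ n) 1"
  by (induction n) (simp_all)

text \<open>
  Substitution of an element of a possibly noncommutative algebra into a polynomial over the base
  field. It carries the factorisation of \<open>X ^ p - X\<close> over to the algebra.
\<close>

definition eval_poly :: "'f poly \<Rightarrow> 'a \<Rightarrow> 'a" where
  "eval_poly q x = (\<Sum>i\<le>degree q. scale (coeff q i) (x ^ i))"

lemma eval_poly_altdef:
  "degree q \<le> n \<Longrightarrow> eval_poly q x = (\<Sum>i\<le>n. scale (coeff q i) (x ^ i))"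
  unfolding eval_poly_def by (intro sum.mono_neutral_left) (auto simp: coeff_eq_0)

lemma eval_poly_add: "eval_poly (q + r) x = eval_poly q x + eval_poly r x"
proof -
  let ?n = "max (degree q) (degree r)"
  have "degree (q + r) \<le> ?n" by (rule degree_add_le_max)
  then show ?thesis
    by (simp add: eval_poly_altdef[of _ ?n] scale_left_distrib sum.distrib)
qed

lemma eval_poly_diff: "eval_poly (q - r) x = eval_poly q x - eval_poly r x"
proof -
  have "eval_poly (q - r) x + eval_poly r x = eval_poly q x"
    by (simp flip: eval_poly_add)
  then show ?thesis by (simp add: algebra_simps)
qed

lemma eval_poly_smult: "eval_poly (Polynomial.smult c q) x = scale c (eval_poly q x)"
  by (simp add: eval_poly_altdef[of "Polynomial.smult c q" "degree q"] degree_smult_le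
      eval_poly_def scale_sum_right)

lemma eval_poly_0 [simp]: "eval_poly 0 x = 0"
  by (simp add: eval_poly_def)

lemma eval_poly_monom: "eval_poly (monom c n) x = scale c (x ^ n)"
proof -
  have "eval_poly (monom c n) x = (\<Sum>i\<le>n. if i = n then scale c (x ^ i) else 0)"
    unfolding eval_poly_altdef[OF degree_monom_le] by (rule sum.cong) simp_all
  then show ?thesis by simp
qed

lemma eval_poly_pCons: "eval_poly (pCons c q) x = scale c 1 + x * eval_poly q x"
proof -
  have "eval_poly (pCons c q) x
      = (\<Sum>i\<le>Suc (degree q). scale (coeff (pCons c q) i) (x ^ i))"
    by (intro eval_poly_altdef degree_pCons_le)
  also have "\<dots> = scale c 1 + x * eval_poly q x"
    by (subst sum.atMost_Suc_shift)
       (simp add: eval_poly_def sum_distrib_left scale_mult_right)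
  finally show ?thesis .
qed

lemma eval_poly_linear_mult: "eval_poly ([:c, 1:] * q) x = (x + scale c 1) * eval_poly q x"
  by (simp add: eval_poly_add eval_poly_smult eval_poly_pCons distrib_right)

lemma eval_poly_sum: "eval_poly (\<Sum>i\<in>I. q i) x = (\<Sum>i\<in>I. eval_poly (q i) x)"
  by (induction I rule: infinite_finite_induct) (simp_all add: eval_poly_add)

lemma eval_poly_intertwine:
  assumes "a * x = y * a"
  shows "a * eval_poly q x = eval_poly q y * a"
proof (induction q)
  case (pCons c q)
  have "a * (x * eval_poly q x) = y * (a * eval_poly q x)"
    by (simp add: assms flip: mult.assoc)
  then show ?case by (simp add: eval_poly_pCons pCons algebra_simps)
qed simp

lemma eval_poly_pcompose_shift: "eval_poly (pcompose q [:1, 1:]) x = eval_poly q (x + 1)"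
  by (induction q)
     (simp_all add: pcompose_pCons eval_poly_add eval_poly_linear_mult eval_poly_pCons
       algebra_simps)

lemma falling_prime_char:
  fixes x :: 'a
  assumes "prime p" "CHAR('f) = p"
  shows "falling x p = x ^ p - x"
proof -
  have "eval_poly (\<Prod>i<n. [:- of_nat i, 1:]) x = falling x n" for n
  proof (induction n)
    case 0
    have "eval_poly 1 x = 1" using eval_poly_monom[of 1 0 x] by simp
    then show ?case by simp
  next
    case (Suc n)
    have "eval_poly (\<Prod>i<Suc n. [:- of_nat i, 1:]) x
        = (x + scale (- of_nat n) 1) * falling x n"
      by (simp only: prod.lessThan_Suc mult.commute[of _ "[:- of_nat n, 1:]"]
          eval_poly_linear_mult Suc)
    then show ?case by (simp add: scale_of_nat)
  qed
  then show ?thesis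
    by (metis assms eval_poly_diff eval_poly_monom power_one_right scale_one
        prod_linear_factors_prime_char)
qed

lemma artin_schreier_add_intertwined:
  fixes x u :: 'a
  assumes "prime p" "CHAR('f) = p" and "u * x = (x + 1) * u"
  shows "(x + u) ^ p - (x + u) = x ^ p - x + u ^ p"
proof -
  have "falling (x + u) p = falling x p + u ^ p"
    using sum_binomial_prime[OF assms(1) of_nat_CHAR[OF assms(2)],
        of "\<lambda>k. falling x (p - k) * u ^ k"]
    by (simp add: falling_add_intertwined[OF assms(3)])
  then show ?thesis by (simp add: falling_prime_char[OF assms(1,2)])
qed

text \<open>
  The operator \<open>D w = t w - w t\<close> is the difference of left and right multiplication by
  \<open>t\<close>, which satisfy the same Artin--Schreier equation; the constants \<open>\<tau>\<close> cancel in
  \<open>D (D - 1) \<dots> (D - (p - 1))\<close>.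
\<close>

lemma ad_falling_prime_char:
  fixes t w :: 'a
  assumes p: "prime p" and char: "CHAR('f) = p" and t: "t ^ p - t = scale \<tau> 1"
  shows "ad_falling t w p = 0"
proof -
  have "(- t) ^ p = - (t ^ p)"
  proof (cases "p = 2")
    case True
    then have "(2::'a) = 0"
      using of_nat_CHAR[OF char] by simp
    then have "t ^ 2 + t ^ 2 = 0"
      by (simp flip: mult_2)
    then show ?thesis
      using True by (simp add: eq_neg_iff_add_eq_0)
  next
    case False
    then have "odd p"
      using p prime_ge_2_nat[OF p] by (intro prime_odd_nat) auto
    then show ?thesis by simp
  qed
  then have "falling (- t) p = - (t ^ p - t)"
    by (simp add: falling_prime_char[OF p char])
  moreover have "ad_falling t w p = falling t p * w + w * falling (- t) p"
    using sum_binomial_prime[OF p of_nat_CHAR[OF char],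
        of "\<lambda>k. falling t (p - k) * w * falling (- t) k"]
    by (simp add: ad_falling_eq)
  ultimately show ?thesis
    by (simp add: falling_prime_char[OF p char] t)
qed

end

lemma power_intertwine:
  assumes "v * t = (t + c) * v" "v * c = c * v"
  shows "v ^ k * t = (t + of_nat k * c) * (v::'a::ring_1) ^ k"
proof (induction k)
  case (Suc k)
  have "v ^ Suc k * t = v * (v ^ k * t)" by (simp add: mult.assoc)
  also have "\<dots> = (v * t + v * (of_nat k * c)) * v ^ k"
    unfolding Suc by (simp add: algebra_simps)
  also have "v * (of_nat k * c) = of_nat k * c * v"
    by (simp add: mult_of_nat_left_commute assms mult.assoc)
  finally show ?case by (simp add: assms algebra_simps)
qed simp

section \<open>Artin--Schreier elements of a central division algebra\<close>

context central_division_algebra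
begin

text \<open>
  Replaces the appeal to Skolem--Noether for the automorphism \<open>t \<mapsto> t + 1\<close>.
\<close>

lemma exists_shifting_element:
  assumes p: "prime p" and char: "CHAR('f) = p" and t: "t ^ p - t = scale \<tau> 1"
    and w: "t * w \<noteq> w * t"
  obtains z where "z \<noteq> 0" "z * t = (t + 1) * z"
proof -
  let ?d = "ad_falling t w"
  \<comment> \<open>The step at which \<open>D (D - 1) \<dots> (D - i)\<close> first kills \<open>w\<close> exhibits an
    eigenvector for the eigenvalue \<open>i\<close>; this eigenvalue is not 0 because
    \<open>D w \<noteq> 0\<close>.\<close>
  define m where "m = (LEAST m. ?d m = 0)"
  have "?d p = 0" by (rule ad_falling_prime_char[OF p char t])
  then have m: "?d m = 0" "m \<le> p"
    unfolding m_def by (auto intro: LeastI Least_le)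
  have "?d 0 \<noteq> 0" "?d 1 \<noteq> 0" using w by auto
  then have "m \<noteq> 0" "m \<noteq> 1" using m by metis+
  then obtain i where i: "m = Suc i" "0 < i" by (metis One_nat_def gr0_conv_Suc not_gr0)
  define v where "v = ?d i"
  have "v \<noteq> 0"
    unfolding v_def using not_less_Least[of i "\<lambda>m. ?d m = 0"] i by (auto simp: m_def)
  have "v * t = (t + (- of_nat i)) * v"
    using m(1) by (simp add: i v_def algebra_simps)
  then have vk: "v ^ k * t = (t + of_nat k * (- of_nat i)) * v ^ k" for k
    by (rule power_intertwine) (simp add: mult_of_nat_commute)
  \<comment> \<open>Powers of the eigenvector multiply the eigenvalue; choose one that turns it into
    \<open>-1\<close>, which is what \<open>z * t = (t + 1) * z\<close> says.\<close>
  have "\<not> p dvd i" using i m by (auto dest: dvd_imp_le)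
  then have "coprime i p"
    using p by (metis coprime_commute prime_imp_coprime_nat)
  then obtain x where "[i * x = Suc 0] (mod p)"
    using cong_solve_coprime_nat by blast
  then have "[i * x * (p - 1) + 1 = Suc 0 * (p - 1) + 1] (mod p)"
    by (intro cong_add cong_mult cong_refl)
  then have "p dvd i * x * (p - 1) + 1"
    using prime_gt_0_nat[OF p] by (simp add: cong_def mod_eq_0_iff_dvd)
  then obtain r where "i * x * (p - 1) + 1 = p * r" by (auto elim: dvdE)
  then have "of_nat (i * x * (p - 1) + 1) = of_nat p * (of_nat r :: 'a)"
    by (metis of_nat_mult)
  then have "of_nat (i * x * (p - 1)) = (- 1 :: 'a)"
    by (simp add: of_nat_CHAR[OF char] eq_neg_iff_add_eq_0 add.commute del: of_nat_mult)
  then have "of_nat (x * (p - 1)) * (- of_nat i) = (1::'a)"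
    by (simp add: mult_ac del: of_nat_mult flip: of_nat_mult)
  then have "v ^ (x * (p - 1)) * t = (t + 1) * v ^ (x * (p - 1))"
    using vk by metis
  moreover have "v ^ (x * (p - 1)) \<noteq> 0" using \<open>v \<noteq> 0\<close> by simp
  ultimately show thesis using that by blast
qed

end

text \<open>
  The situation of a symbol presentation before it is known that \<open>t ^ p - t\<close> and
  \<open>z ^ p\<close> are scalars.
\<close>

locale shifting_pair = central_division_algebra scale p
  for scale :: "'f::field \<Rightarrow> 'a::division_ring \<Rightarrow> 'a" and p :: nat +
  fixes t z :: 'a
  assumes prime: "prime p" and char: "CHAR('f) = p"
    and z_nonzero: "z \<noteq> 0" and shift: "z * t = (t + 1) * z"
begin

lemma power_shift: "z ^ k * t = (t + of_nat k) * z ^ k"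
  using power_intertwine[of z t 1 k] shift by simp

lemma of_nat_inj:
  assumes "j < p" "k < p" "of_nat j = (of_nat k :: 'a)"
  shows "j = k"
proof -
  have "scale (of_nat j) 1 = scale (of_nat k) 1"
    using assms(3) by (simp add: scale_of_nat)
  then have "of_nat j = (of_nat k :: 'f)"
    by (rule scale_right_imp_eq[rotated]) simp
  then show ?thesis
    using assms(1,2) by (simp add: of_nat_eq_iff_cong_CHAR char cong_def)
qed

text \<open>
  The summands are eigenvectors of \<open>w \<mapsto> w t - t w\<close> for the distinct eigenvalues
  \<open>j\<close>; the operator minus \<open>k\<close> removes the summand of index \<open>k\<close>.
\<close>

lemma powers_independent_over_centralizer:
  assumes "S \<subseteq> {..<p}" "\<And>j. j \<in> S \<Longrightarrow> g j * t = t * g j"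
    and "(\<Sum>j\<in>S. g j * z ^ j) = 0" and "j \<in> S"
  shows "g j = 0"
proof -
  have "finite S" using assms(1) finite_subset by blast
  then show ?thesis using assms
  proof (induction S arbitrary: g j rule: finite_induct)
    case (insert k S)
    let ?c = "\<lambda>j. of_nat j - of_nat k :: 'a"
    have move: "g j * z ^ j * t - t * (g j * z ^ j) - of_nat k * (g j * z ^ j)
        = (?c j * g j) * z ^ j" if "j \<in> insert k S" for j
    proof -
      have "g j * z ^ j * t = (g j * t + g j * of_nat j) * z ^ j"
        by (simp add: power_shift mult.assoc algebra_simps)
      then show ?thesis
        using insert.prems(2)[OF that]
        by (simp add: algebra_simps flip: mult_of_nat_commute)
    qed
    let ?s = "\<Sum>j\<in>insert k S. g j * z ^ j"
    have "?s * t - t * ?s - of_nat k * ?s = (\<Sum>j\<in>insert k S. (?c j * g j) * z ^ j)"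
      unfolding sum_distrib_left sum_distrib_right sum_subtractf[symmetric]
      by (intro sum.cong refl move)
    then have "(\<Sum>j\<in>S. (?c j * g j) * z ^ j) = 0"
      using insert by simp
    moreover have "(?c j * g j) * t = t * (?c j * g j)" if "j \<in> S" for j
    proof -
      have "t * (?c j * g j) = ?c j * (t * g j)"
        by (simp add: left_diff_distrib right_diff_distrib mult_of_nat_left_commute)
      then show ?thesis using insert.prems(2)[of j] that by (simp add: mult.assoc)
    qed
    ultimately have cg: "?c j * g j = 0" if "j \<in> S" for j
      using insert.IH[of "\<lambda>j. ?c j * g j" j] insert.prems(1) that by blast
    have g: "g j = 0" if "j \<in> S" for j
    proof -
      have "j < p" "k < p" "j \<noteq> k" using that insert.prems(1) insert.hyps by auto
      then have "?c j \<noteq> 0" using of_nat_inj[of j k] by auto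
      then show ?thesis using cg[OF that] by simp
    qed
    then have "g k * z ^ k = 0"
      using insert.prems(3) insert.hyps by simp
    then have "g k = 0" using z_nonzero by simp
    then show ?case using g insert.prems(4) by auto
  qed simp
qed

text \<open>
  Conjugation by \<open>z\<close> shows that \<open>t + 1\<close> is a root as well, so for \<open>q\<close> of least
  degree \<open>q (X + 1) - q (X)\<close> vanishes; then \<open>q\<close> is constant on the prime field, which has
  too many elements for its degree.
\<close>

lemma eval_poly_eq_0:
  assumes "degree q < p" "eval_poly q t = 0"
  shows "q = 0"
  using assms
proof (induction "degree q" arbitrary: q rule: less_induct)
  case less
  have deg0: "degree q = 0"
  proof (rule ccontr)
    assume pos: "degree q \<noteq> 0"
    define r where "r = pcompose q [:1, 1:] - q"
    have "degree r < degree q"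
    proof (rule degree_lessI)
      show "r \<noteq> 0 \<or> degree q > 0" using pos by simp
      have d: "degree (pcompose q [:1, 1:]) = degree q" by (simp add: degree_pcompose)
      have "coeff (pcompose q [:1, 1:]) (degree q) = lead_coeff q"
        using lead_coeff_comp[of "[:1, 1:]" q] d by simp
      then show "\<forall>k\<ge>degree q. coeff r k = 0"
        using d by (auto simp: r_def coeff_eq_0 le_less)
    qed
    have "z * eval_poly q t = eval_poly q (t + 1) * z"
      using shift by (rule eval_poly_intertwine)
    then have "eval_poly q (t + 1) = 0"
      using less.prems z_nonzero by (metis mult_eq_0_iff)
    then have "eval_poly r t = 0"
      by (simp add: r_def eval_poly_diff eval_poly_pcompose_shift less.prems)
    with less \<open>degree r < degree q\<close> have "r = 0" by force
    then have per: "poly q (c + 1) = poly q c" for c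
    proof -
      have "poly (pcompose q [:1, 1:]) c = poly q c"
        using \<open>r = 0\<close> by (simp add: r_def)
      then show ?thesis by (simp add: poly_pcompose add.commute)
    qed
    have roots: "poly q (of_nat i) = poly [:poly q 0:] (of_nat i)" for i
    proof (induction i)
      case (Suc i)
      then show ?case using per[of "of_nat i"] by (simp add: add.commute)
    qed simp
    have "inj_on (of_nat :: nat \<Rightarrow> 'f) {..<p}"
      by (auto simp: inj_on_def of_nat_eq_iff_cong_CHAR char cong_def)
    then have "card ((of_nat :: nat \<Rightarrow> 'f) ` {..<p}) = p"
      by (simp add: card_image)
    then have "q = [:poly q 0:]"
      using roots less.prems by (intro poly_eqI_degree[of "of_nat ` {..<p}"]) auto
    then show False using pos by (metis degree_pCons_0)
  qed
  then obtain c where c: "q = [:c:]" by (auto elim: degree_eq_zeroE)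
  then show ?case using less.prems by (simp add: eval_poly_pCons)
qed

lemma monomials_independent:
  assumes "(\<Sum>(i, j)\<in>{..<p} \<times> {..<p}. scale (c i j) (t ^ i * z ^ j)) = 0"
    and "i < p" "j < p"
  shows "c i j = 0"
proof -
  define q where "q j = (\<Sum>i<p. monom (c i j) i)" for j
  have coeff: "coeff (q j) i = (if i < p then c i j else 0)" for i j
    by (simp add: q_def coeff_sum)
  have "degree (q j) < p" for j
  proof (rule degree_lessI)
    show "q j \<noteq> 0 \<or> 0 < p" using prime_gt_0_nat[OF prime] by simp
  qed (simp add: coeff)
  have "0 = (\<Sum>j<p. \<Sum>i<p. scale (c i j) (t ^ i * z ^ j))"
    using assms(1) by (subst sum.swap) (simp add: sum.cartesian_product)
  also have "\<dots> = (\<Sum>j<p. eval_poly (q j) t * z ^ j)"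
    by (simp add: q_def eval_poly_sum eval_poly_monom sum_distrib_right scale_mult_left)
  finally have "eval_poly (q j) t = 0"
    using assms(3) eval_poly_intertwine[of t t t]
    by (intro powers_independent_over_centralizer[where S = "{..<p}" and g = "\<lambda>j. eval_poly (q j) t"])
      simp_all
  then have "q j = 0" using \<open>degree (q j) < p\<close> by (intro eval_poly_eq_0)
  then show ?thesis using coeff[of j i] assms by simp
qed

text \<open>
  Independence suffices because the number of monomials is the dimension \<open>p\<^sup>2\<close>.
\<close>

lemma monomials_span:
  obtains c where "a = (\<Sum>(i, j)\<in>{..<p} \<times> {..<p}. scale (c i j) (t ^ i * z ^ j))"
proof -
  let ?P = "{..<p} \<times> {..<p}" and ?m = "\<lambda>(i, j). t ^ i * z ^ j"
  have indep: "c k = 0" if "(\<Sum>k\<in>?P. scale (c k) (?m k)) = 0" "k \<in> ?P" for c k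
    using monomials_independent[of "curry c" "fst k" "snd k"] that
    by (auto simp: case_prod_unfold)
  have inj: "inj_on ?m ?P"
  proof (rule inj_onI, rule ccontr)
    fix k l assume kl: "k \<in> ?P" "l \<in> ?P" "?m k = ?m l" "k \<noteq> l"
    define c where "c r = (if r = k then 1 else if r = l then - 1 else 0 :: 'f)" for r
    have "(\<Sum>r\<in>?P. scale (c r) (?m r)) = (\<Sum>r\<in>{k, l}. scale (c r) (?m r))"
      using kl by (intro sum.mono_neutral_right) (auto simp: c_def)
    also have "\<dots> = 0" using kl by (simp add: c_def)
    finally show False using indep[of c k] kl by (simp add: c_def)
  qed
  let ?B = "?m ` ?P"
  have "independent ?B"
  proof
    assume "dependent ?B"
    then obtain u v where u: "v \<in> ?B" "u v \<noteq> 0" "(\<Sum>v\<in>?B. scale (u v) v) = 0"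
      by (subst (asm) dependent_finite) auto
    then obtain k where k: "k \<in> ?P" "v = ?m k" by blast
    have "(\<Sum>k\<in>?P. scale (u (?m k)) (?m k)) = 0"
      using u(3) by (simp add: sum.reindex[OF inj])
    then show False using indep[of "\<lambda>k. u (?m k)" k] u(2) k by simp
  qed
  then obtain B where B: "?B \<subseteq> B" "independent B" "UNIV \<subseteq> span B"
    using maximal_independent_subset_extend[of ?B UNIV] by auto
  then have "card B = p ^ 2"
    using basis_card_eq_dim[of B UNIV] degree by simp
  moreover have "card ?B = p ^ 2"
    by (simp add: card_image[OF inj] power2_eq_square)
  moreover have "finite B"
    using calculation prime_gt_0_nat[OF prime] card_ge_0_finite by force
  ultimately have "?B = B" using B(1) by (simp add: card_subset_eq)
  then have "a \<in> span ?B" using B(3) by blast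
  then obtain u where "a = (\<Sum>v\<in>?B. scale (u v) v)"
    by (subst (asm) span_finite) auto
  then have "a = (\<Sum>k\<in>?P. scale (u (?m k)) (?m k))"
    by (simp add: sum.reindex[OF inj])
  then show thesis
    by (intro that[of "\<lambda>i j. u (t ^ i * z ^ j)"]) (simp add: case_prod_unfold)
qed

text \<open>
  The power commutes with \<open>t\<close>, since \<open>t + p = t\<close>, and with \<open>z\<close>, and these
  generate the algebra.
\<close>

lemma power_central:
  obtains \<delta> where "z ^ p = scale \<delta> 1" "\<delta> \<noteq> 0"
proof -
  have t: "z ^ p * t = t * z ^ p"
    using power_shift[of p] by (simp add: of_nat_CHAR[OF char])
  have m: "z ^ p * (t ^ i * z ^ j) = t ^ i * z ^ j * z ^ p" for i j
  proof -
    have "z ^ p * t ^ i = t ^ i * z ^ p"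
      using t by (metis power_commuting_commutes)
    then show ?thesis
      by (metis mult.assoc power_add add.commute)
  qed
  have "z ^ p * a = a * z ^ p" for a
  proof -
    obtain c where "a = (\<Sum>(i, j)\<in>{..<p} \<times> {..<p}. scale (c i j) (t ^ i * z ^ j))"
      by (rule monomials_span)
    then show ?thesis
      by (simp add: sum_distrib_left sum_distrib_right case_prod_unfold m
          scale_mult_left scale_mult_right)
  qed
  then obtain \<delta> where "z ^ p = scale \<delta> 1"
    using center_eq by blast
  moreover have "z ^ p \<noteq> 0" using z_nonzero by simp
  ultimately show thesis using that by auto
qed

end

section \<open>The free algebra and its quotients\<close>

lemma single_Cons: "Poly_Mapping.single (g # w) c = free_gen g * Poly_Mapping.single w (c::'f::field)"
  by (simp add: free_gen_def mult_single plus_list_def)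

lemma single_eq_const_mult: "Poly_Mapping.single w c = free_const c * Poly_Mapping.single w (1::'f::field)"
  by (simp add: free_const_def mult_single plus_list_def)

lemma single_Nil_one: "Poly_Mapping.single [] 1 = (1 :: 'f::field free_algebra)"
  by (simp flip: zero_list_def)

lemma free_algebra_induct [case_names zero single add]:
  assumes "P 0" "\<And>w c. P (Poly_Mapping.single w c)" "\<And>f h. P f \<Longrightarrow> P h \<Longrightarrow> P (f + h)"
  shows "P (f :: 'f::field free_algebra)"
proof (induction f rule: update_induct)
  case (update f a b)
  have "Poly_Mapping.update a b f = Poly_Mapping.single a b + f"
    using update(1) by (intro poly_mapping_eqI)
      (auto simp: lookup_update lookup_add lookup_single when_def not_in_keys_iff_lookup_eq_zero)
  then show ?case using assms update by simp
qed (rule assms)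

lemma free_const_commute: "f * free_const c = free_const c * (f :: 'f::field free_algebra)"
  by (induction f rule: free_algebra_induct)
     (simp_all add: free_const_def mult_single plus_list_def mult.commute distrib_left distrib_right)

lemma field_algebra_free: "field_algebra (\<lambda>c (f :: 'f::field free_algebra). free_const c * f)"
proof
  fix a b :: 'f and x y :: "'f free_algebra"
  show "free_const a * (x + y) = free_const a * x + free_const a * y"
    by (simp add: distrib_left)
  show "free_const (a + b) * x = free_const a * x + free_const b * x"
    by (simp add: free_const_def single_add distrib_right)
  show "free_const a * (free_const b * x) = free_const (a * b) * x"
    by (simp add: free_const_def mult_single plus_list_def flip: mult.assoc)
  show "free_const 1 * x = x"
    by (simp add: free_const_def single_Nil_one)
  show "free_const a * x * y = free_const a * (x * y)"
    by (rule mult.assoc)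
  show "x * (free_const a * y) = free_const a * (x * y)"
    by (simp add: free_const_commute flip: mult.assoc)
qed

context field_algebra
begin

definition free_lift :: "(generator \<Rightarrow> 'a) \<Rightarrow> 'f free_algebra \<Rightarrow> 'a" where
  "free_lift g f = (\<Sum>w\<in>Poly_Mapping.keys f. scale (Poly_Mapping.lookup f w) (prod_list (map g w)))"

lemma free_lift_0 [simp]: "free_lift g 0 = 0"
  by (simp add: free_lift_def)

lemma free_lift_add: "free_lift g (f + h) = free_lift g f + free_lift g h"
  unfolding free_lift_def
  by (rule setsum_keys_plus_distrib) (simp_all add: scale_left_distrib)

lemma free_lift_single: "free_lift g (Poly_Mapping.single w c) = scale c (prod_list (map g w))"
  by (simp add: free_lift_def)

lemma free_lift_mult: "free_lift g (f * h) = free_lift g f * free_lift g h"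
proof (induction f rule: free_algebra_induct)
  case (single w c)
  show ?case
    by (induction h rule: free_algebra_induct)
       (simp_all add: mult_single plus_list_def free_lift_single distrib_left free_lift_add
         scale_mult_left scale_mult_right mult.commute)
qed (simp_all add: distrib_right free_lift_add)

lemma free_lift_const: "free_lift g (free_const c) = scale c 1"
  by (simp add: free_const_def free_lift_single)

lemma free_lift_gen: "free_lift g (free_gen e) = g e"
  by (simp add: free_gen_def free_lift_single)

lemma free_lift_1: "free_lift g 1 = 1"
  by (simp add: free_lift_single flip: single_Nil_one)

lemma ring_algebra_of: "ring (algebra_of scale)"
proof (rule ringI)
  show "abelian_group (algebra_of scale)"
    by (rule abelian_groupI)
       (auto simp: algebra_of_def add.assoc add.commute intro: exI[of _ "- _"])
  show "Group.monoid (algebra_of scale)"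
    by (rule monoidI) (auto simp: algebra_of_def mult.assoc)
qed (auto simp: algebra_of_def distrib_left distrib_right)

end

lemma algebra_of_simps [simp]:
  "carrier (algebra_of scale) = UNIV" "monoid.mult (algebra_of scale) = (*)"
  "one (algebra_of scale) = 1" "zero (algebra_of scale) = 0" "add (algebra_of scale) = (+)"
  "Module.smult (algebra_of scale) = scale"
  by (simp_all add: algebra_of_def)

lemma quotient_algebra_simps [simp]:
  "carrier (quotient_algebra A I) = a_rcosets\<^bsub>A\<^esub> I"
  "monoid.mult (quotient_algebra A I) = rcoset_mult A I"
  "one (quotient_algebra A I) = I +>\<^bsub>A\<^esub> \<one>\<^bsub>A\<^esub>"
  "add (quotient_algebra A I) = set_add A"
  "Module.smult (quotient_algebra A I) = (\<lambda>c X. \<Union>x\<in>X. I +>\<^bsub>A\<^esub> (c \<odot>\<^bsub>A\<^esub> x))"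
  by (simp_all add: quotient_algebra_def ring.defs module.defs FactRing_def)

lemma free_algebra_simps [simp]:
  "carrier free_algebra = UNIV" "monoid.mult free_algebra = (*)"
  "one free_algebra = 1" "zero free_algebra = 0" "add free_algebra = (+)"
  "Module.smult free_algebra = (\<lambda>c f. free_const c * f)"
  by (simp_all add: free_algebra_def)

lemma ring_free_algebra: "ring (free_algebra :: ('f::field, 'f free_algebra) module)"
  unfolding free_algebra_def by (rule field_algebra.ring_algebra_of[OF field_algebra_free])

lemma a_minus_free_algebra: "f \<ominus>\<^bsub>free_algebra\<^esub> h = f - (h :: 'f::field free_algebra)"
proof -
  interpret ring "free_algebra :: ('f, 'f free_algebra) module" by (rule ring_free_algebra)
  have "\<ominus>\<^bsub>free_algebra\<^esub> h = - h"
    using r_neg[of h] by (simp add: eq_neg_iff_add_eq_0 add.commute)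
  then show ?thesis by (simp add: a_minus_def)
qed

text \<open>
  Ideals of the free algebra, with membership and coset arithmetic expressed by the operations of
  the type instead of those of the record.
\<close>

locale free_ideal = ideal I free_algebra for I :: "'f::field free_algebra set"
begin

lemma add_mem: "f \<in> I \<Longrightarrow> h \<in> I \<Longrightarrow> f + h \<in> I"
  using additive_subgroup.a_closed[OF is_additive_subgroup, of f h] by simp

lemma zero_mem: "0 \<in> I"
  using additive_subgroup.zero_closed[OF is_additive_subgroup] by simp

lemma mult_mem: "f \<in> I \<Longrightarrow> h * f * k \<in> I"
  using I_l_closed[of f h] I_r_closed[of "h * f" k] by simp

lemma coset_eq_iff: "I +>\<^bsub>free_algebra\<^esub> f = I +>\<^bsub>free_algebra\<^esub> h \<longleftrightarrow> f - h \<in> I"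
  using quotient_eq_iff_same_a_r_cos[OF ideal_axioms, of f h] by (simp add: a_minus_free_algebra)

lemma mem_coset_iff: "h \<in> I +>\<^bsub>free_algebra\<^esub> f \<longleftrightarrow> h - f \<in> I"
  unfolding a_r_coset_def' by (auto simp: algebra_simps) (metis add.commute diff_add_cancel)

lemma coset_mult: "rcoset_mult free_algebra I (I +>\<^bsub>free_algebra\<^esub> f) (I +>\<^bsub>free_algebra\<^esub> h)
    = I +>\<^bsub>free_algebra\<^esub> (f * h)"
  using rcoset_mult_add[of f h] by simp

lemma coset_add: "set_add free_algebra (I +>\<^bsub>free_algebra\<^esub> f) (I +>\<^bsub>free_algebra\<^esub> h)
    = I +>\<^bsub>free_algebra\<^esub> (f + h)"
  using a_rcos_sum[of f h] by simp

lemma coset_smult: "(\<Union>x\<in>I +>\<^bsub>free_algebra\<^esub> f. I +>\<^bsub>free_algebra\<^esub> (free_const c * x))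
    = I +>\<^bsub>free_algebra\<^esub> (free_const c * f)"
proof -
  have "I +>\<^bsub>free_algebra\<^esub> (free_const c * x) = I +>\<^bsub>free_algebra\<^esub> (free_const c * f)"
    if "x \<in> I +>\<^bsub>free_algebra\<^esub> f" for x
    using that mult_mem[of "x - f" "free_const c" 1]
    by (simp add: coset_eq_iff mem_coset_iff right_diff_distrib)
  moreover have "f \<in> I +>\<^bsub>free_algebra\<^esub> f" by (simp add: mem_coset_iff zero_mem)
  ultimately show ?thesis by blast
qed

end

locale free_algebra_hom = field_algebra scale
  for scale :: "'f::field \<Rightarrow> 'a::ring_1 \<Rightarrow> 'a" +
  fixes \<phi> :: "'f free_algebra \<Rightarrow> 'a"
  assumes hom_add: "\<phi> (f + h) = \<phi> f + \<phi> h"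
    and hom_mult: "\<phi> (f * h) = \<phi> f * \<phi> h"
    and hom_1: "\<phi> 1 = 1"
    and hom_const_mult: "\<phi> (free_const c * f) = scale c (\<phi> f)"
begin

lemma hom_0: "\<phi> 0 = 0"
  using hom_add[of 0 0] by simp

lemma hom_diff: "\<phi> (f - h) = \<phi> f - \<phi> h"
  using hom_add[of "f - h" h] by (simp add: algebra_simps)

lemma hom_power: "\<phi> (f ^ n) = \<phi> f ^ n"
  by (induction n) (simp_all add: hom_1 hom_mult)

lemma hom_const: "\<phi> (free_const c) = scale c 1"
  using hom_const_mult[of c 1] by (simp add: hom_1)

lemma hom_sum: "\<phi> (sum f S) = (\<Sum>i\<in>S. \<phi> (f i))"
  by (induction S rule: infinite_finite_induct) (simp_all add: hom_0 hom_add)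

lemma ideal_kernel: "ideal {f. \<phi> f = 0} free_algebra"
proof (rule idealI)
  show "ring (free_algebra :: ('f, 'f free_algebra) module)" by (rule ring_free_algebra)
  show "subgroup {f. \<phi> f = 0} (add_monoid free_algebra)"
  proof (rule group.subgroupI)
    interpret ring "free_algebra :: ('f, 'f free_algebra) module" by (rule ring_free_algebra)
    show "group (add_monoid (free_algebra :: ('f, 'f free_algebra) module))"
      by (rule add.is_group)
    have m: "inv\<^bsub>add_monoid free_algebra\<^esub> f = - f" for f :: "'f free_algebra"
      using a_minus_free_algebra[of 0 f] by (simp add: a_minus_def a_inv_def)
    show "inv\<^bsub>add_monoid free_algebra\<^esub> f \<in> {f. \<phi> f = 0}" if "f \<in> {f. \<phi> f = 0}" for f
      using that hom_diff[of 0 f] unfolding m by (simp add: hom_0)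
  qed (auto simp: hom_add intro: exI[of _ 0] hom_0)
qed (auto simp: hom_mult)

text \<open>
  The first isomorphism theorem, for algebras.
\<close>

lemma quotient_isomorphic:
  assumes "surj \<phi>" "{f. \<phi> f = 0} = I"
  shows "algebra_isomorphic (algebra_of scale) (quotient_algebra free_algebra I)"
proof -
  interpret free_ideal I
    using ideal_kernel unfolding assms(2) free_ideal_def .
  let ?c = "\<lambda>f. I +>\<^bsub>free_algebra\<^esub> f"
  have c: "?c f = ?c h \<longleftrightarrow> \<phi> f = \<phi> h" for f h
    unfolding coset_eq_iff by (simp add: hom_diff flip: assms(2))
  define s where "s = inv_into UNIV \<phi>"
  have s [simp]: "\<phi> (s a) = a" for a
    by (simp add: s_def surj_f_inv_f assms(1))
  have ex [simp]: "\<exists>f. a = \<phi> f" for a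
    by (metis s)
  have sc: "?c (s (\<phi> f)) = ?c f" for f
    by (simp add: c)
  have "(\<lambda>a. ?c (s a)) \<in> ring_iso (algebra_of scale) (quotient_algebra free_algebra I)"
  proof (rule ring_iso_memI)
    show "bij_betw (\<lambda>a. ?c (s a)) (carrier (algebra_of scale))
        (carrier (quotient_algebra free_algebra I))"
      unfolding bij_betw_def
    proof
      show "inj_on (\<lambda>a. ?c (s a)) (carrier (algebra_of scale))"
        by (rule inj_onI) (simp add: c)
      have "carrier (quotient_algebra free_algebra I) = range ?c"
        by (auto simp: A_RCOSETS_def')
      also have "\<dots> = range (\<lambda>a. ?c (s a))"
        using sc by (metis (no_types, lifting) image_subset_iff range_subsetD rangeI subset_antisym subsetI imageE)
      finally show "(\<lambda>a. ?c (s a)) ` carrier (algebra_of scale)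
          = carrier (quotient_algebra free_algebra I)" by simp
    qed
  qed (auto simp: coset_mult coset_add c hom_mult hom_add hom_1 A_RCOSETS_def')
  moreover have "?c (s (scale k a)) = (\<Union>x\<in>?c (s a). ?c (free_const k * x))" for k a
    by (simp add: coset_smult c hom_const_mult)
  ultimately show ?thesis
    unfolding algebra_isomorphic_def by (intro bexI) auto
qed

end

text \<open>
  The projection to the quotient followed by the inverse of the isomorphism.
\<close>

lemma (in field_algebra) algebra_isomorphic_quotientE:
  assumes "algebra_isomorphic (algebra_of scale) (quotient_algebra free_algebra I)"
    and "ideal I (free_algebra :: ('f, 'f free_algebra) module)"
  obtains \<phi> where "free_algebra_hom scale \<phi>" "\<And>f. f \<in> I \<Longrightarrow> \<phi> f = 0"
proof -
  interpret I: free_ideal I using assms(2) unfolding free_ideal_def .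
  let ?c = "\<lambda>f. I +>\<^bsub>free_algebra\<^esub> f"
  obtain h where h: "h \<in> ring_iso (algebra_of scale) (quotient_algebra free_algebra I)"
    and hs: "h (scale c a) = (\<Union>x\<in>h a. ?c (free_const c * x))" for c a
    using assms(1) unfolding algebra_isomorphic_def by auto
  note iso = ring_iso_memE[OF h, simplified]
  define \<phi> where "\<phi> f = inv_into UNIV h (?c f)" for f
  have "?c f \<in> range h" for f
    using iso(5) by (auto simp: bij_betw_def A_RCOSETS_def')
  then have h\<phi>: "h (\<phi> f) = ?c f" for f
    unfolding \<phi>_def by (rule f_inv_into_f)
  have inj: "\<phi> f = a" if "h a = ?c f" for f a
  proof -
    have "inj h" using iso(5) by (simp add: bij_betw_def)
    then show ?thesis by (rule injD) (simp add: h\<phi> that)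
  qed
  have hom: "free_algebra_hom scale \<phi>"
  proof
    show "\<phi> (f + k) = \<phi> f + \<phi> k" for f k
      by (rule inj) (simp add: iso h\<phi> I.coset_add)
    show "\<phi> (f * k) = \<phi> f * \<phi> k" for f k
      by (rule inj) (simp add: iso h\<phi> I.coset_mult)
    show "\<phi> 1 = 1"
      by (rule inj) (simp add: iso)
    show "\<phi> (free_const c * f) = scale c (\<phi> f)" for c f
      by (rule inj) (simp add: hs h\<phi> I.coset_smult)
  qed
  moreover have "\<phi> f = 0" if "f \<in> I" for f
  proof -
    have "?c f = ?c 0" using that by (simp add: I.coset_eq_iff)
    then show ?thesis
      using free_algebra_hom.hom_0[OF hom] by (simp add: \<phi>_def)
  qed
  ultimately show thesis using that by blast
qed

section \<open>Presentations by symbols\<close>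

lemma symbol_ideal: "ideal (Idl\<^bsub>free_algebra\<^esub> (symbol_relators p \<alpha> \<beta>)) free_algebra"
  by (intro ring.genideal_ideal ring_free_algebra) simp

lemma symbol_relators_mem: "symbol_relators p \<alpha> \<beta> \<subseteq> Idl\<^bsub>free_algebra\<^esub> (symbol_relators p \<alpha> \<beta>)"
  by (intro ring.genideal_self ring_free_algebra) simp

lemma (in field_algebra) symbol_presentation_generators:
  assumes "symbol_presentation p scale \<alpha> \<beta>"
  obtains x y where "x ^ p - x = scale \<alpha> 1" "y ^ p = scale \<beta> 1" "y * x = (x + 1) * y"
proof -
  let ?S = "symbol_relators p \<alpha> \<beta>"
  obtain \<phi> where "free_algebra_hom scale \<phi>" and I: "\<And>f. f \<in> Idl\<^bsub>free_algebra\<^esub> ?S \<Longrightarrow> \<phi> f = 0"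
    using assms algebra_isomorphic_quotientE[OF _ symbol_ideal]
    unfolding symbol_presentation_def symbol_algebra_def by metis
  then interpret free_algebra_hom scale \<phi> by simp
  let ?x = "free_gen Gen_x" and ?y = "free_gen Gen_y"
  have z: "\<phi> f = 0" if "f \<in> ?S" for f
    using that I symbol_relators_mem by blast
  show thesis
  proof (rule that)
    show "\<phi> ?x ^ p - \<phi> ?x = scale \<alpha> 1"
      using z[of "?x ^ p - ?x - free_const \<alpha>"]
      by (simp add: symbol_relators_def Let_def hom_diff hom_power hom_const)
    show "\<phi> ?y ^ p = scale \<beta> 1"
      using z[of "?y ^ p - free_const \<beta>"]
      by (simp add: symbol_relators_def Let_def hom_diff hom_power hom_const)
    show "\<phi> ?y * \<phi> ?x = (\<phi> ?x + 1) * \<phi> ?y"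
      using z[of "?y * ?x - (?x + 1) * ?y"]
      by (simp add: symbol_relators_def Let_def hom_diff hom_mult hom_add hom_1)
  qed
qed

text \<open>
  Modulo an ideal that contains the relators, the monomials \<open>X\<^sup>i Y\<^sup>j\<close> with
  \<open>i, j < p\<close> span: the relations allow rewriting every word to this form. An upper bound on the
  quotient is all that is needed, because the independence of the images in the division algebra supplies
  the lower one.
\<close>

locale symbol_relations = free_ideal I
  for I :: "'f::field free_algebra set" and p :: nat and \<alpha> \<beta> :: 'f +
  assumes p: "p \<ge> 2" and relators: "symbol_relators p \<alpha> \<beta> \<subseteq> I"
begin

abbreviation (input) X :: "'f free_algebra" where "X \<equiv> free_gen Gen_x"
abbreviation (input) Y :: "'f free_algebra" where "Y \<equiv> free_gen Gen_y"

definition normalizable :: "'f free_algebra set" where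
  "normalizable = {f. \<exists>c. f - (\<Sum>(i, j)\<in>{..<p} \<times> {..<p}. free_const (c i j) * (X ^ i * Y ^ j)) \<in> I}"

lemma free_const_add: "free_const (c + d :: 'f) = free_const c + free_const d"
  by (simp add: free_const_def single_add)

lemma free_const_mult: "free_const (c * d :: 'f) = free_const c * free_const d"
  by (simp add: free_const_def mult_single plus_list_def)

lemma normalizable_add:
  assumes "f \<in> normalizable" "h \<in> normalizable"
  shows "f + h \<in> normalizable"
proof -
  let ?s = "\<lambda>c. \<Sum>(i, j)\<in>{..<p} \<times> {..<p}. free_const (c i j :: 'f) * (X ^ i * Y ^ j)"
  obtain c d where "f - ?s c \<in> I" "h - ?s d \<in> I"
    using assms by (auto simp: normalizable_def)
  then have "(f - ?s c) + (h - ?s d) \<in> I" by (rule add_mem)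
  also have "(f - ?s c) + (h - ?s d) = f + h - ?s (\<lambda>i j. c i j + d i j)"
    by (simp add: free_const_add distrib_right case_prod_unfold sum.distrib)
  finally show ?thesis by (auto simp: normalizable_def)
qed

lemma normalizable_const_mult:
  assumes "f \<in> normalizable"
  shows "free_const k * f \<in> normalizable"
proof -
  let ?s = "\<lambda>c. \<Sum>(i, j)\<in>{..<p} \<times> {..<p}. free_const (c i j :: 'f) * (X ^ i * Y ^ j)"
  obtain c where "f - ?s c \<in> I"
    using assms by (auto simp: normalizable_def)
  then have "free_const k * (f - ?s c) * 1 \<in> I" by (rule mult_mem)
  also have "free_const k * (f - ?s c) * 1 = free_const k * f - ?s (\<lambda>i j. k * c i j)"
    by (simp add: free_const_mult right_diff_distrib case_prod_unfold sum_distrib_left mult.assoc)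
  finally show ?thesis by (auto simp: normalizable_def)
qed

lemma free_const_0: "free_const (0::'f) = 0" and free_const_1: "free_const (1::'f) = 1"
  by (simp_all add: free_const_def single_Nil_one)

lemma ideal_normalizable: "f \<in> I \<Longrightarrow> f \<in> normalizable"
  unfolding normalizable_def by (auto simp: free_const_0 intro!: exI[of _ "\<lambda>_ _. 0"])

lemma normalizable_cong: "f - h \<in> I \<Longrightarrow> h \<in> normalizable \<Longrightarrow> f \<in> normalizable"
  using normalizable_add[OF ideal_normalizable, of "f - h" h] by simp

lemma normalizable_sum:
  "(\<And>i. i \<in> S \<Longrightarrow> f i \<in> normalizable) \<Longrightarrow> sum f S \<in> normalizable"
  by (induction S rule: infinite_finite_induct)
     (simp_all add: normalizable_add ideal_normalizable zero_mem)

lemma relator_mem: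
  "X ^ p - X - free_const \<alpha> \<in> I" "Y ^ p - free_const \<beta> \<in> I" "Y * X - (X + 1) * Y \<in> I"
  using relators by (auto simp: symbol_relators_def Let_def)

text \<open>
  The relations \<open>X ^ p = X + \<alpha>\<close> and \<open>Y ^ p = \<beta>\<close> lower the exponents. The first
  one does so because \<open>p \<ge> 2\<close>.
\<close>

lemma monomial_normalizable: "X ^ i * Y ^ j \<in> normalizable"
proof (induction "i + j" arbitrary: i j rule: less_induct)
  case less
  consider "i < p" "j < p" | k where "i = k + p" | k where "j = k + p"
    by (metis add.commute le_Suc_ex not_le)
  then show ?case
  proof cases
    case 1
    let ?m = "\<lambda>(i, j). X ^ i * Y ^ j"
    have "(\<Sum>r\<in>{..<p} \<times> {..<p}. free_const (if r = (i, j) then 1 else 0) * ?m r) = ?m (i, j)"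
      using 1 by (simp add: if_distrib[of free_const] if_distrib[of "\<lambda>c. c * _"] free_const_0
          free_const_1 cong: if_cong)
    then show ?thesis
      unfolding normalizable_def
      by (auto simp: case_prod_unfold zero_mem
          intro!: exI[of _ "\<lambda>k l. if (k, l) = (i, j) then 1 else 0"])
  next
    case (2 k)
    have "X ^ k * (X ^ p - X - free_const \<alpha>) * Y ^ j \<in> I"
      by (rule mult_mem) (rule relator_mem)
    also have "X ^ k * (X ^ p - X - free_const \<alpha>) * Y ^ j
        = X ^ i * Y ^ j - (X ^ (k + 1) * Y ^ j + free_const \<alpha> * (X ^ k * Y ^ j))"
      by (simp add: 2 power_add power_commutes algebra_simps flip: free_const_commute)
    finally show ?thesis
      by (rule normalizable_cong)
        (use p in \<open>intro normalizable_add normalizable_const_mult less, simp_all add: 2\<close>)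
  next
    case (3 k)
    have "(X ^ i * Y ^ k) * (Y ^ p - free_const \<beta>) * 1 \<in> I"
      by (rule mult_mem) (rule relator_mem)
    also have "(X ^ i * Y ^ k) * (Y ^ p - free_const \<beta>) * 1
        = X ^ i * Y ^ j - free_const \<beta> * (X ^ i * Y ^ k)"
      by (simp add: 3 power_add algebra_simps free_const_commute)
    finally show ?thesis
      by (rule normalizable_cong)
        (use p in \<open>intro normalizable_const_mult less, simp_all add: 3\<close>)
  qed
qed

lemma normalizable_left_mult:
  assumes "\<And>i j. h * (X ^ i * Y ^ j) \<in> normalizable" "f \<in> normalizable"
  shows "h * f \<in> normalizable"
proof -
  let ?s = "\<lambda>c. \<Sum>(i, j)\<in>{..<p} \<times> {..<p}. free_const (c i j :: 'f) * (X ^ i * Y ^ j)"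
  obtain c where "f - ?s c \<in> I"
    using assms by (auto simp: normalizable_def)
  then have "h * (f - ?s c) * 1 \<in> I" by (rule mult_mem)
  then have "h * f - h * ?s c \<in> I" by (simp add: right_diff_distrib)
  moreover have "h * (free_const a * m) = free_const a * (h * m)" for a m
    by (metis free_const_commute mult.assoc)
  then have "h * ?s c \<in> normalizable"
    using assms(1)
    by (auto simp: sum_distrib_left case_prod_unfold
        intro!: normalizable_sum normalizable_const_mult)
  ultimately show ?thesis by (rule normalizable_cong)
qed

lemma X_mult_normalizable: "f \<in> normalizable \<Longrightarrow> X * f \<in> normalizable"
proof (rule normalizable_left_mult)
  show "X * (X ^ i * Y ^ j) \<in> normalizable" for i j
    using monomial_normalizable[of "Suc i" j] by (simp add: mult.assoc)
qed

lemma Y_mult_normalizable: "f \<in> normalizable \<Longrightarrow> Y * f \<in> normalizable"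
proof (rule normalizable_left_mult)
  show "Y * (X ^ i * Y ^ j) \<in> normalizable" for i j
  proof (induction i)
    case 0
    show ?case using monomial_normalizable[of 0 "Suc j"] by simp
  next
    case (Suc i)
    let ?m = "X ^ i * Y ^ j"
    have "1 * (Y * X - (X + 1) * Y) * ?m \<in> I"
      by (rule mult_mem) (rule relator_mem)
    then have "Y * (X ^ Suc i * Y ^ j) - (X * (Y * ?m) + Y * ?m) \<in> I"
      by (simp add: algebra_simps)
    then show ?case
      using Suc Suc by (rule normalizable_cong[OF _ normalizable_add[OF X_mult_normalizable]])
  qed
qed

lemma normalizable_all: "f \<in> normalizable"
proof (induction f rule: free_algebra_induct)
  case (single w c)
  have "Poly_Mapping.single w 1 \<in> normalizable"
  proof (induction w)
    case Nil
    show ?case using monomial_normalizable[of 0 0] by (simp add: single_Nil_one)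
  next
    case (Cons g w)
    then show ?case
      by (cases g) (simp_all add: single_Cons X_mult_normalizable Y_mult_normalizable)
  qed
  then show ?case
    by (subst single_eq_const_mult) (rule normalizable_const_mult)
qed (simp_all add: normalizable_add ideal_normalizable zero_mem)

end

text \<open>
  The relators hold in the division algebra; conversely an element of the kernel has a normal form,
  whose image vanishes only if all coefficients do.
\<close>

lemma (in shifting_pair) symbol_presentation:
  assumes t: "t ^ p - t = scale \<tau> 1" and z: "z ^ p = scale \<delta> 1" and "\<delta> \<noteq> 0"
  shows "symbol_presentation p scale \<tau> \<delta>"
proof -
  let ?I = "Idl\<^bsub>free_algebra\<^esub> (symbol_relators p \<tau> \<delta>)"
  let ?X = "free_gen Gen_x :: 'f free_algebra" and ?Y = "free_gen Gen_y :: 'f free_algebra"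
  define \<phi> where "\<phi> = free_lift (case_generator t z)"
  interpret free_algebra_hom scale \<phi>
    by standard (simp_all add: \<phi>_def free_lift_add free_lift_mult free_lift_1 free_lift_const)
  interpret symbol_relations ?I p \<tau> \<delta>
    using prime_ge_2_nat[OF prime] symbol_ideal[of p \<tau> \<delta>] symbol_relators_mem[of p \<tau> \<delta>]
    by (simp add: symbol_relations_def free_ideal_def symbol_relations_axioms_def)
  have gen: "\<phi> ?X = t" "\<phi> ?Y = z"
    by (simp_all add: \<phi>_def free_lift_gen)
  have normal: "\<phi> (\<Sum>(i, j)\<in>{..<p} \<times> {..<p}. free_const (c i j) * (?X ^ i * ?Y ^ j))
      = (\<Sum>(i, j)\<in>{..<p} \<times> {..<p}. scale (c i j) (t ^ i * z ^ j))" for c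
    by (simp only: hom_sum case_prod_unfold hom_const_mult) (simp only: hom_mult hom_power gen)
  have "surj \<phi>"
  proof (rule surjI)
    fix a
    obtain c where "a = (\<Sum>(i, j)\<in>{..<p} \<times> {..<p}. scale (c i j) (t ^ i * z ^ j))"
      by (rule monomials_span)
    then have "\<phi> (\<Sum>(i, j)\<in>{..<p} \<times> {..<p}. free_const (c i j) * (?X ^ i * ?Y ^ j)) = a"
      using normal[of c] by (simp only:)
    then have "\<exists>f. \<phi> f = a" ..
    then show "\<phi> (SOME f. \<phi> f = a) = a" by (rule someI_ex)
  qed
  have ker: "?I \<subseteq> {f. \<phi> f = 0}"
  proof (rule ring.genideal_minimal[OF ring_free_algebra ideal_kernel])
    show "symbol_relators p \<tau> \<delta> \<subseteq> {f. \<phi> f = 0}"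
      by (auto simp: symbol_relators_def Let_def hom_diff hom_power hom_mult hom_add hom_1
          hom_const gen t z shift)
  qed
  have "f \<in> ?I" if "\<phi> f = 0" for f
  proof -
    obtain c where c: "f - (\<Sum>(i, j)\<in>{..<p} \<times> {..<p}. free_const (c i j) * (?X ^ i * ?Y ^ j)) \<in> ?I"
      using normalizable_all[of f] unfolding normalizable_def by blast
    then have "(\<Sum>(i, j)\<in>{..<p} \<times> {..<p}. scale (c i j) (t ^ i * z ^ j)) = 0"
      using ker that by (auto simp: hom_diff normal)
    then have "c i j = 0" if "i < p" "j < p" for i j
      using that by (rule monomials_independent)
    then have "(\<Sum>(i, j)\<in>{..<p} \<times> {..<p}. free_const (c i j) * (?X ^ i * ?Y ^ j)) = 0"
      by (intro sum.neutral) (auto simp: free_const_0)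
    then show ?thesis using c by simp
  qed
  then have "{f. \<phi> f = 0} = ?I" using ker by blast
  then show ?thesis
    using quotient_isomorphic[OF \<open>surj \<phi>\<close>] \<open>\<delta> \<noteq> 0\<close>
    by (simp add: symbol_presentation_def symbol_algebra_def)
qed

section \<open>Right linked algebras are left linked\<close>

lemma (in field_algebra) power_add_commuting_prime_char:
  fixes x c :: 'a
  assumes "prime p" "CHAR('f) = p" and cx: "c * x = x * c"
  shows "(x + c) ^ p = x ^ p + c ^ p"
proof -
  have "(x + c) ^ n = (\<Sum>k\<le>n. of_nat (n choose k) * (x ^ (n - k) * c ^ k))" for n
  proof (induction n)
    case (Suc n)
    define A where "A m k = x ^ m * c ^ k" for m k
    have cA: "c * A m k = A m (Suc k)" for m k
      using power_commuting_commutes[OF cx[symmetric], of m]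
      by (simp add: A_def flip: mult.assoc)
    have xA: "x * A m k = A (Suc m) k" for m k
      by (simp add: A_def mult.assoc)
    have "(x + c) ^ Suc n = (\<Sum>k\<le>n. (x + c) * (of_nat (n choose k) * A (n - k) k))"
      by (simp add: Suc A_def sum_distrib_left)
    also have "\<dots> = (\<Sum>k\<le>n. of_nat (n choose k) * (A (Suc (n - k)) k + A (n - k) (Suc k)))"
      by (simp only: mult_of_nat_left_commute[of "x + c"]) (simp only: distrib_right xA cA)
    finally show ?case unfolding sum_binomial_Suc by (simp only: A_def)
  qed simp
  then show ?thesis
    using sum_binomial_prime[OF assms(1) of_nat_CHAR[OF assms(2)], of "\<lambda>k. x ^ (p - k) * c ^ k"]
    by simp
qed

text \<open>
  The new first generator is \<open>x + u\<close>. Its only freedom lies in \<open>u\<close>, which changes the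
  Artin--Schreier constant by \<open>u ^ p\<close>.
\<close>

lemma (in central_division_algebra) symbol_presentation_of_shifted_generator:
  assumes p: "prime p" "CHAR('f) = p" "n = p"
    and y: "y \<noteq> 0" "y * x = (x + 1) * y"
    and u: "u * x = (x + 1) * u"
    and \<tau>: "x ^ p - x + u ^ p = scale \<tau> 1"
  obtains \<delta> where "symbol_presentation p scale \<tau> \<delta>"
proof -
  define t where "t = x + u"
  have t: "t ^ p - t = scale \<tau> 1"
    unfolding t_def by (simp add: artin_schreier_add_intertwined[OF p(1,2) u] \<tau>)
  obtain w where "t * w \<noteq> w * t"
  proof (cases "u = 0")
    case True
    have "t * y \<noteq> y * t" using y by (simp add: t_def True distrib_right)
    then show thesis by (rule that)
  next
    case False
    have "t * x \<noteq> x * t" using False by (simp add: t_def distrib_right distrib_left u)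
    then show thesis by (rule that)
  qed
  then obtain z where z: "z \<noteq> 0" "z * t = (t + 1) * z"
    by (rule exists_shifting_element[OF p(1,2) t])
  interpret shifting_pair scale p t z
    using p z central_division_algebra_axioms
    by (simp add: shifting_pair_def shifting_pair_axioms_def)
  obtain \<delta> where "z ^ p = scale \<delta> 1" "\<delta> \<noteq> 0"
    by (rule power_central)
  then have "symbol_presentation p scale \<tau> \<delta>"
    by (rule symbol_presentation[OF t])
  then show thesis by (rule that)
qed

theorem theorem3p3:
  fixes p :: nat
    and scale :: "'f::field \<Rightarrow> 'a::division_ring \<Rightarrow> 'a"
    and scale' :: "'f \<Rightarrow> 'b::division_ring \<Rightarrow> 'b"
  assumes "prime p"
    and "CHAR('f) = p"
    and "central_division_algebra scale p"
    and "central_division_algebra scale' p"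
    and "right_linked p scale scale'"
  shows "left_linked p scale scale'"
proof -
  interpret A: central_division_algebra scale p by fact
  interpret A': central_division_algebra scale' p by fact
  obtain \<alpha> \<gamma> \<beta> where pres: "symbol_presentation p scale \<alpha> \<beta>" "symbol_presentation p scale' \<gamma> \<beta>"
    using assms(5) unfolding right_linked_def by blast
  then have "\<beta> \<noteq> 0" unfolding symbol_presentation_def by blast
  obtain x y where xy: "x ^ p - x = scale \<alpha> 1" "y ^ p = scale \<beta> 1" "y * x = (x + 1) * y"
    using pres(1) by (rule A.symbol_presentation_generators)
  obtain x' y' where xy': "x' ^ p - x' = scale' \<gamma> 1" "y' ^ p = scale' \<beta> 1" "y' * x' = (x' + 1) * y'"
    using pres(2) by (rule A'.symbol_presentation_generators)
  have p0: "p > 0" using assms(1) by (rule prime_gt_0_nat)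
  have "y \<noteq> 0" "y' \<noteq> 0"
    using xy(2) xy'(2) \<open>\<beta> \<noteq> 0\<close> p0 by (auto simp: zero_power)
  \<comment> \<open>The solution of \<open>\<alpha> + \<beta> (\<alpha> + a ^ p - a) = \<gamma> + \<beta> a ^ p\<close>.\<close>
  define a where "a = (\<alpha> - \<gamma>) / \<beta> + \<alpha>"
  define \<tau> where "\<tau> = \<gamma> + \<beta> * a ^ p"
  have \<tau>: "\<tau> = \<alpha> + \<beta> * (\<alpha> + a ^ p - a)"
    using \<open>\<beta> \<noteq> 0\<close> by (simp add: \<tau>_def a_def field_simps)
  obtain \<delta> where "symbol_presentation p scale \<tau> \<delta>"
  proof (rule A.symbol_presentation_of_shifted_generator[OF assms(1,2) refl \<open>y \<noteq> 0\<close> xy(3)])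
    define s where "s = x + scale a 1"
    show "(y * s) * x = (x + 1) * (y * s)"
    proof -
      have "s * x = x * s" by (simp add: s_def distrib_left distrib_right)
      then have "(y * s) * x = y * x * s" by (simp add: mult.assoc)
      then show ?thesis by (simp add: xy(3) mult.assoc)
    qed
    have "y * s = (s + 1) * y"
      by (simp add: s_def distrib_left distrib_right xy(3))
    then have "(y * s) ^ p = y ^ p * falling s p"
      by (rule power_mult_intertwined)
    then have "(y * s) ^ p = scale \<beta> (s ^ p - s)"
      by (simp add: A.falling_prime_char[OF assms(1,2)] xy(2))
    also have "s ^ p = x ^ p + scale (a ^ p) 1"
      unfolding s_def
      by (subst A.power_add_commuting_prime_char[OF assms(1,2)]) (simp_all add: A.scale_one_power)
    also have "x ^ p + scale (a ^ p) 1 - s = scale (\<alpha> + a ^ p - a) 1"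
      using xy(1) by (simp add: s_def A.scale_left_distrib A.scale_left_diff_distrib algebra_simps)
    finally show "x ^ p - x + (y * s) ^ p = scale \<tau> 1"
      by (simp add: xy(1) \<tau> A.scale_left_distrib)
  qed
  moreover obtain \<delta>' where "symbol_presentation p scale' \<tau> \<delta>'"
  proof (rule A'.symbol_presentation_of_shifted_generator[OF assms(1,2) refl \<open>y' \<noteq> 0\<close> xy'(3)])
    let ?u = "scale' a y'"
    show "?u * x' = (x' + 1) * ?u"
      by (simp add: A'.scale_mult_left A'.scale_mult_right xy'(3))
    have "?u ^ k = scale' (a ^ k) (y' ^ k)" for k
      by (induction k) (simp_all add: A'.scale_mult_left A'.scale_mult_right mult.commute)
    then show "x' ^ p - x' + ?u ^ p = scale' \<tau> 1"
      by (simp add: xy' \<tau>_def A'.scale_left_distrib mult.commute)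
  qed
  ultimately show ?thesis
    unfolding left_linked_def by blast
qed

end
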